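(* Let $n \geq 0$ and let $d$ be an integer. For every set of leaves $B \subseteq 2^n$ with $\mathrm{LTD}(B) \leq d$, \[ |B| \leq \binom{n}{0} + \binom{n}{1} + \cdots + \binom{n}{d}. \]
   Context: For $n \geq 0$, $2^{\leq n}$ denotes the set of binary sequences of length at most $n$, and $2^n$ the set of binary sequences of length exactly $n$; the elements of $2^n$ are called leaves. For nodes $a,b$, write $a \prec b$ if $a$ is a proper initial segment of $b$. The meet $b \wedge b'$ is the longest common initial segment of $b$ and $b'$. Write $b \sim b'$ if $|b| = |b'|$. For a leaf $b$, its branch $\check b$ is the set of all initial segments of $b$, including $b$ itself. For $B \subseteq 2^n$, let $\check B = \bigcup_{b\in B}\check b$, the set of all initial segments of elements of $B$. The leveled binary tree of height $d$ is the structure $\widetilde T_d = (2^{\leq d}, \prec, \wedge, \sim)$. For substructures, an embedding $f$ from $(A,\prec,\wedge,\sim)$ into $(A',\prec,\wedge,\sim)$ is an injective map satisfying, for all $a,a' \in A$: - $a \prec a'$ iff $f(a) \prec f(a')$; - $f(a \wedge a') = f(a) \wedge f(a')$; - $a \sim a'$ iff $f(a) \sim f(a')$. For nonempty $B \subseteq 2^n$, the leveled tree dimension $\mathrm{LTD}(B)$ is the largest nonnegative integer $d$ such that $\widetilde T_d$ embeds in $(\check B, \prec, \wedge, \sim)$. If $B = \emptyset$, set $\mathrm{LTD}(B) = -1$. Binomial coefficients $\binom{n}{i}$ with $i > n$ are $0$. *)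

theory Defs
  imports "HOL-Library.Sublist" "HOL-Library.FuncSet"
begin

(* A node of the binary tree is a bool list with the root at []: the relation strict_prefix is
   "proper initial segment", longest_common_prefix is the meet, and a ~ b is length a = length b. *)

type_synonym node = "bool list"

definition nodes_upto :: "nat \<Rightarrow> node set" where
  "nodes_upto n = {a. length a \<le> n}"

definition leaves :: "nat \<Rightarrow> node set" where
  "leaves n = {b. length b = n}"

definition branch :: "node \<Rightarrow> node set" where
  "branch b = {a. prefix a b}"

definition branches :: "node set \<Rightarrow> node set" where
  "branches B = (\<Union>b\<in>B. branch b)"

(* Intended for sets A closed under meets; nodes_upto d and branches B are both closed
   under initial segments. *)
definition leveled_tree_embedding :: "(node \<Rightarrow> node) \<Rightarrow> node set \<Rightarrow> node set \<Rightarrow> bool" where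
  "leveled_tree_embedding f A A' \<longleftrightarrow>
     f \<in> A \<rightarrow> A' \<and> inj_on f A \<and>
     (\<forall>a\<in>A. \<forall>a'\<in>A. strict_prefix a a' \<longleftrightarrow> strict_prefix (f a) (f a')) \<and>
     (\<forall>a\<in>A. \<forall>a'\<in>A. f (longest_common_prefix a a') = longest_common_prefix (f a) (f a')) \<and>
     (\<forall>a\<in>A. \<forall>a'\<in>A. length a = length a' \<longleftrightarrow> length (f a) = length (f a'))"

definition leveled_tree_embeds :: "node set \<Rightarrow> node set \<Rightarrow> bool" where
  "leveled_tree_embeds A A' \<longleftrightarrow> (\<exists>f. leveled_tree_embedding f A A')"

(* For nonempty B contained in leaves n the largest d exists: d = 0 always embeds,
   and an embedding of nodes_upto d maps a chain of d + 1 nodes injectively into a branch,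
   so d \<le> n. *)
definition LTD :: "node set \<Rightarrow> int" where
  "LTD B = (if B = {} then - 1
            else int (GREATEST d. leveled_tree_embeds (nodes_upto d) (branches B)))"

end

theory Submission
  imports Defs
begin

text \<open>
  Encode a set of levels below \<open>n\<close> by a word \<open>s\<close> of length \<open>n\<close>, and call it shattered by \<open>B\<close> if
  the branches of \<open>B\<close> contain a copy of a complete binary tree that branches exactly at the levels
  marked in \<open>s\<close>. As in Pajor's proof of the Sauer--Shelah lemma, \<open>B\<close> shatters at least \<open>|B|\<close> words:
  split \<open>B\<close> by the first bit into \<open>B\<^sub>0\<close> and \<open>B\<^sub>1\<close>; the words shattered by either half remain
  shattered when the root is unmarked, and those shattered by both halves also when it is
  marked. A shattered word with \<open>k\<close> marked levels yields an embedding of the leveled binary tree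
  of height \<open>k\<close>, so \<open>k \<le> d\<close>.
\<close>

definition subtree :: "bool \<Rightarrow> node set \<Rightarrow> node set" where
  "subtree x B = {b. x # b \<in> B}"

text \<open>Both halves must shatter the same rest \<open>s\<close> below a mark, so the copy
  branches at the same levels everywhere. At an unmarked level the bit \<open>x\<close> may differ
  from node to node.\<close>

fun shatters :: "node set \<Rightarrow> bool list \<Rightarrow> bool" where
  "shatters B [] \<longleftrightarrow> B \<noteq> {}"
| "shatters B (False # s) \<longleftrightarrow> (\<exists>x. shatters (subtree x B) s)"
| "shatters B (True # s) \<longleftrightarrow> (\<forall>x. shatters (subtree x B) s)"

text \<open>\<open>level s i\<close> is the position of the \<open>i\<close>-th mark of \<open>s\<close>, counted from 0; it continues past the
  last mark so that it is strictly increasing everywhere.\<close>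

fun level :: "bool list \<Rightarrow> nat \<Rightarrow> nat" where
  "level [] i = i"
| "level (False # s) i = Suc (level s i)"
| "level (True # s) 0 = 0"
| "level (True # s) (Suc i) = Suc (level s i)"

lemma finite_leaves: "finite (leaves n)"
  using finite_lists_length_eq[of "UNIV :: bool set" n] by (simp add: leaves_def)

lemma leaves_Suc: "leaves (Suc n) = (\<Union>x. (#) x ` leaves n)"
  by (auto simp: leaves_def length_Suc_conv)

lemma subtree_leaves: "B \<subseteq> leaves (Suc n) \<Longrightarrow> subtree x B \<subseteq> leaves n"
  by (auto simp: subtree_def leaves_def)

lemma card_subtrees:
  assumes "B \<subseteq> leaves (Suc n)"
  shows "card B = card (subtree False B) + card (subtree True B)"
proof -
  have fin: "finite (subtree x B)" for x
    using subtree_leaves[OF assms] finite_leaves by (rule finite_subset)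
  have "b \<in> (#) False ` subtree False B \<union> (#) True ` subtree True B" if "b \<in> B" for b
  proof -
    obtain x c where "b = x # c"
      using \<open>b \<in> B\<close> assms unfolding leaves_Suc by blast
    with that show ?thesis
      by (cases x) (auto simp: subtree_def)
  qed
  then have "B = (#) False ` subtree False B \<union> (#) True ` subtree True B"
    by (auto simp: subtree_def)
  also have "card \<dots> = card ((#) False ` subtree False B) + card ((#) True ` subtree True B)"
    by (rule card_Un_disjoint) (auto simp: fin)
  finally show ?thesis
    by (simp add: card_image)
qed

lemma card_le_card_shattered:
  assumes "B \<subseteq> leaves n"
  shows "card B \<le> card {s \<in> leaves n. shatters B s}"
  using assms
proof (induction n arbitrary: B)
  case 0
  show ?case
  proof (cases "B = {}")
    case False
    with 0 have "B = {[]}" by (auto simp: leaves_def)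
    moreover have "{s \<in> leaves 0. shatters B s} = {[]}"
      using False by (auto simp: leaves_def)
    ultimately show ?thesis by simp
  qed simp
next
  case (Suc n)
  define S where "S x = {s \<in> leaves n. shatters (subtree x B) s}" for x
  have fin: "finite (S x)" for x
    by (simp add: S_def finite_leaves)
  have IH: "card (subtree x B) \<le> card (S x)" for x
    using Suc.IH[OF subtree_leaves[OF Suc.prems]] by (simp add: S_def)
  have eq: "{s \<in> leaves (Suc n). shatters B s} =
      (#) False ` (S False \<union> S True) \<union> (#) True ` (S False \<inter> S True)"
    by (auto simp: leaves_Suc S_def all_bool_eq ex_bool_eq)
  have "card B \<le> card (S False) + card (S True)"
    using IH[of False] IH[of True] card_subtrees[OF Suc.prems] by simp
  \<comment> \<open>Words shattered by both halves count twice on either side: in the word count,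
    once behind \<open>False\<close> and once behind \<open>True\<close>.\<close>
  also have "\<dots> = card (S False \<union> S True) + card (S False \<inter> S True)"
    by (rule card_Un_Int) (simp_all add: fin)
  also have "\<dots> = card ((#) False ` (S False \<union> S True)) + card ((#) True ` (S False \<inter> S True))"
    by (simp add: card_image)
  also have "\<dots> = card {s \<in> leaves (Suc n). shatters B s}"
    unfolding eq by (rule card_Un_disjoint[symmetric]) (auto simp: fin)
  finally show ?case .
qed

lemma strict_mono_level: "strict_mono (level s)"
proof -
  have "level s i < level s (Suc i)" for i
    by (induction s i rule: level.induct) (auto elim: level.elims)
  then show ?thesis by (simp add: strict_mono_Suc_iff)
qed

lemma longest_common_prefix_eq_left_iff: "longest_common_prefix a b = a \<longleftrightarrow> prefix a b"
  by (metis longest_common_prefix_max_prefix longest_common_prefix_prefix1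
      longest_common_prefix_prefix2 prefix_order.antisym prefix_order.order_refl)

text \<open>The initial segment order is definable from the meet, so preserving meets and sending
  levels to levels in a strictly increasing way already gives every clause of an embedding.\<close>

lemma level_meet_embedding:
  assumes len: "\<And>a. a \<in> A \<Longrightarrow> length (f a) = l (length a)" and l: "strict_mono (l :: nat \<Rightarrow> nat)"
    and meet: "\<And>a b. a \<in> A \<Longrightarrow> b \<in> A \<Longrightarrow>
      f (longest_common_prefix a b) = longest_common_prefix (f a) (f b)"
    and closed: "\<And>a b. a \<in> A \<Longrightarrow> b \<in> A \<Longrightarrow> longest_common_prefix a b \<in> A"
    and into: "f \<in> A \<rightarrow> A'"
  shows "leveled_tree_embedding f A A'"
proof -
  have len_iff: "length a = length b \<longleftrightarrow> length (f a) = length (f b)" if "a \<in> A" "b \<in> A" for a b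
    using that len strict_mono_eq[OF l] by simp
  \<comment> \<open>Nodes with equal images have equal length, and comparable nodes of equal length
    coincide. Reflection of the order and injectivity both rest on this.\<close>
  have eq: "a = b" if "a \<in> A" "b \<in> A" "prefix a b" "f a = f b" for a b
    using that len_iff[of a b] by (auto simp: prefix_def)
  have prefix_iff: "prefix a b \<longleftrightarrow> prefix (f a) (f b)" if ab: "a \<in> A" "b \<in> A" for a b
  proof -
    have "prefix (f a) (f b) \<longleftrightarrow> f (longest_common_prefix a b) = f a"
      using meet[OF ab] by (simp add: longest_common_prefix_eq_left_iff)
    also have "\<dots> \<longleftrightarrow> longest_common_prefix a b = a"
      using eq closed ab longest_common_prefix_prefix1 by metis
    finally show ?thesis
      by (simp add: longest_common_prefix_eq_left_iff)
  qed
  have inj: "inj_on f A"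
    using eq prefix_iff by (metis inj_onI prefix_order.order_refl)
  have "strict_prefix a b \<longleftrightarrow> strict_prefix (f a) (f b)" if "a \<in> A" "b \<in> A" for a b
    using prefix_iff[OF that] inj that by (auto simp: strict_prefix_def inj_on_def)
  with inj into meet len_iff show ?thesis
    unfolding leveled_tree_embedding_def by blast
qed

lemma branches_Cons: "a \<in> branches (subtree x B) \<Longrightarrow> x # a \<in> branches B"
  by (auto simp: branches_def branch_def subtree_def intro: bexI[of _ "x # _"])

text \<open>Prescribing the exact image levels, rather than only preserving equality of levels,
  makes the embeddings built for the two halves compatible.\<close>

definition level_embedding :: "(node \<Rightarrow> node) \<Rightarrow> bool list \<Rightarrow> node set \<Rightarrow> bool" where
  "level_embedding f s B \<longleftrightarrow> (\<forall>a \<in> nodes_upto (count_list s True).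
     f a \<in> branches B \<and> length (f a) = level s (length a) \<and>
     (\<forall>b \<in> nodes_upto (count_list s True).
       f (longest_common_prefix a b) = longest_common_prefix (f a) (f b)))"

lemma shatters_level_embedding:
  assumes "shatters B s"
  shows "\<exists>f. level_embedding f s B"
  using assms
proof (induction B s rule: shatters.induct)
  case (1 B)
  then show ?case
    by (intro exI[of _ "\<lambda>_. []"])
      (auto simp: level_embedding_def nodes_upto_def branches_def branch_def)
next
  case (2 B s)
  then obtain x f where "level_embedding f s (subtree x B)"
    by (metis shatters.simps(2))
  then show ?case
    by (intro exI[of _ "\<lambda>a. x # f a"]) (simp add: level_embedding_def branches_Cons)
next
  case (3 B s)
  then have "\<forall>x. \<exists>f. level_embedding f s (subtree x B)"
    by simp
  then obtain f where f: "\<And>x. level_embedding (f x) s (subtree x B)"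
    by metis
  \<comment> \<open>The two embeddings are glued below a new root. Both follow
    \<open>level s\<close>, so nodes of equal length still land on one level, and nodes from
    different halves meet at the root before and after mapping.\<close>
  define g where "g a = (case a of [] \<Rightarrow> [] | x # c \<Rightarrow> x # f x c)" for a
  have g_simps [simp]: "g [] = []" "g (x # c) = x # f x c" for x c
    by (simp_all add: g_def)
  have Cons_iff: "x # c \<in> nodes_upto (count_list (True # s) True) \<longleftrightarrow>
      c \<in> nodes_upto (count_list s True)" for x c
    by (simp add: nodes_upto_def)
  have into: "f x c \<in> branches (subtree x B)" and len: "length (f x c) = level s (length c)"
    and meet: "c' \<in> nodes_upto (count_list s True) \<Longrightarrow>
      f x (longest_common_prefix c c') = longest_common_prefix (f x c) (f x c')"
    if "c \<in> nodes_upto (count_list s True)" for x c c'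
    using f[of x] that unfolding level_embedding_def by blast+
  \<comment> \<open>This only serves to show that \<open>B\<close> is nonempty, so that the root
    lies in \<open>branches B\<close>.\<close>
  have "f True [] \<in> branches (subtree True B)"
    by (rule into) (simp add: nodes_upto_def)
  then have root: "[] \<in> branches B"
    by (auto simp: branches_def branch_def subtree_def)
  have "g a \<in> branches B \<and> length (g a) = level (True # s) (length a)"
    if "a \<in> nodes_upto (count_list (True # s) True)" for a
    using that root into len by (cases a) (simp_all only: Cons_iff, simp_all add: branches_Cons)
  moreover have "g (longest_common_prefix a b) = longest_common_prefix (g a) (g b)"
    if "a \<in> nodes_upto (count_list (True # s) True)"
      and "b \<in> nodes_upto (count_list (True # s) True)" for a b
    using that meet by (cases a; cases b) (simp_all only: Cons_iff, simp_all)
  ultimately show ?case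
    unfolding level_embedding_def by blast
qed

lemma shatters_embeds:
  assumes "shatters B s"
  shows "leveled_tree_embeds (nodes_upto (count_list s True)) (branches B)"
proof -
  obtain f where f: "level_embedding f s B"
    using shatters_level_embedding[OF assms] by blast
  have "longest_common_prefix a b \<in> nodes_upto k" if "a \<in> nodes_upto k" for a b k
    using that prefix_length_le[OF longest_common_prefix_prefix1[of a b]]
    by (simp add: nodes_upto_def)
  with f have "leveled_tree_embedding f (nodes_upto (count_list s True)) (branches B)"
    by (intro level_meet_embedding[where l = "level s"] strict_mono_level)
      (auto simp: level_embedding_def)
  then show ?thesis
    by (auto simp: leveled_tree_embeds_def)
qed

text \<open>Lengths strictly increase along the image of the all-\<open>True\<close> chain. The
  resulting bound is what makes the \<open>GREATEST\<close> in \<open>LTD\<close> attained.\<close>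

lemma embeds_height_le:
  assumes "leveled_tree_embeds (nodes_upto k) (branches B)" and "B \<subseteq> leaves n"
  shows "k \<le> n"
proof -
  obtain f where f: "f \<in> nodes_upto k \<rightarrow> branches B"
    and sp: "\<And>a b. a \<in> nodes_upto k \<Longrightarrow> b \<in> nodes_upto k \<Longrightarrow>
      strict_prefix a b \<Longrightarrow> strict_prefix (f a) (f b)"
    using assms(1) by (auto simp: leveled_tree_embeds_def leveled_tree_embedding_def)
  have "i \<le> length (f (replicate i True))" if "i \<le> k" for i
    using that
  proof (induction i)
    case (Suc i)
    have "strict_prefix (replicate i True) (replicate (Suc i) True)"
      by (simp add: strict_prefix_def prefix_def flip: replicate_append_same)
    then have "strict_prefix (f (replicate i True)) (f (replicate (Suc i) True))"
      using Suc.prems by (intro sp) (simp_all add: nodes_upto_def)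
    then show ?case
      using Suc prefix_length_less by fastforce
  qed simp
  then have "k \<le> length (f (replicate k True))" by simp
  moreover have "f (replicate k True) \<in> branches B"
    using f by (auto simp: nodes_upto_def)
  then have "length (f (replicate k True)) \<le> n"
    using assms(2) prefix_length_le by (fastforce simp: branches_def branch_def leaves_def)
  ultimately show ?thesis by simp
qed

lemma embeds_le_LTD:
  assumes "leveled_tree_embeds (nodes_upto k) (branches B)" "B \<subseteq> leaves n" "B \<noteq> {}"
  shows "int k \<le> LTD B"
  using Greatest_le_nat[of "\<lambda>k. leveled_tree_embeds (nodes_upto k) (branches B)" k n]
    assms embeds_height_le by (simp add: LTD_def)

text \<open>Splitting by the first bit gives Pascal's rule.\<close>

lemma card_lists_count_True: "card {s \<in> leaves n. count_list s True = k} = n choose k"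
proof (induction n arbitrary: k)
  case 0
  have "{s \<in> leaves 0. count_list s True = k} = (if k = 0 then {[]} else {})"
    by (auto simp: leaves_def)
  then show ?case by (cases k) (simp_all only:, simp_all)
next
  case IH: (Suc n)
  let ?C = "\<lambda>n k. {s \<in> leaves n. count_list s True = k}"
  show ?case
  proof (cases k)
    case 0
    have "?C (Suc n) 0 = (#) False ` ?C n 0"
      by (auto simp: leaves_Suc split: if_splits)
    with 0 IH show ?thesis by (simp add: card_image)
  next
    case (Suc j)
    have "?C (Suc n) (Suc j) = (#) True ` ?C n j \<union> (#) False ` ?C n (Suc j)"
      by (auto simp: leaves_Suc split: if_splits)
    also have "card \<dots> = card ((#) True ` ?C n j) + card ((#) False ` ?C n (Suc j))"
      by (rule card_Un_disjoint) (auto simp: finite_leaves)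
    finally show ?thesis by (simp add: card_image IH Suc)
  qed
qed

theorem theorem1p3:
  fixes n :: nat and d :: int and B :: "node set"
  assumes "B \<subseteq> leaves n" and "LTD B \<le> d"
  shows "card B \<le> (\<Sum>i\<in>{0..d}. n choose nat i)"
proof (cases "B = {}")
  case False
  have "card B \<le> card {s \<in> leaves n. shatters B s}"
    using assms(1) by (rule card_le_card_shattered)
  also have "\<dots> \<le> card (\<Union>i\<in>{0..d}. {s \<in> leaves n. count_list s True = nat i})"
  proof (rule card_mono)
    \<comment> \<open>For negative \<open>d\<close> this says that no word is shattered, in
      agreement with the empty union.\<close>
    have "int (count_list s True) \<le> d" if "shatters B s" for s
      using embeds_le_LTD[OF shatters_embeds[OF that] assms(1) False] assms(2) by simp
    then show "{s \<in> leaves n. shatters B s} \<subseteq>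
        (\<Union>i\<in>{0..d}. {s \<in> leaves n. count_list s True = nat i})"
      by (auto intro!: bexI[of _ "int (count_list _ True)"])
  qed (simp add: finite_leaves)
  also have "\<dots> \<le> (\<Sum>i\<in>{0..d}. card {s \<in> leaves n. count_list s True = nat i})"
    by (rule card_UN_le) simp
  finally show ?thesis
    by (simp add: card_lists_count_True)
qed simp

end
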